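(* Let $\alpha\ge 0$, $L>0$ and $i\in\{1,2\}$. For any $u\in L^2_{w_i^{\alpha,L}}([0,\infty))$, $$\|I_nu\|_{L^2_{w_i^{\alpha,L}}([0,\infty))}\;\lesssim\;\sqrt{\pi}\,\|u\|_{L^\infty([0,\infty))}\qquad (n\text{ sufficiently large}),$$ where $\lesssim$ means "asymptotically less than or equal to" as $n\to\infty$.
   Context: For $\alpha>-1/2$, $G_k^{\alpha}$ denotes the degree-$k$ Gegenbauer polynomial, orthogonal on $[-1,1]$ with respect to $w^\alpha(x)=(1-x^2)^{\alpha-1/2}$ and normalized by $G_k^\alpha(1)=1$ (Chebyshev polynomials of the first kind for $\alpha=0$). Let $x_{n,0}^\alpha,\dots,x_{n,n}^\alpha$ be the zeros of $G_{n+1}^\alpha$. For $L>0$, $t\ge0$ set $T_{1,L}(t)=(t-L)/(t+L)$, $T_{2,L}(t)=1-2e^{-t/L}$, and for $i\in\{1,2\}$ put $\mathcal{G}_{i,k}^{\alpha,L}(t)=G_k^\alpha(T_{i,L}(t))$ and nodes ${}_i^Lt_{n,j}^\alpha=T_{i,L}^{-1}(x_{n,j}^\alpha)$, $j=0,\dots,n$. Weight functions on $[0,\infty)$: $w_1^{\alpha,L}(t)=\dfrac{4^\alpha L^{\alpha+1/2}t^{\alpha-1/2}}{(t+L)^{2\alpha+1}}$ and $w_2^{\alpha,L}(t)=\dfrac2L e^{-t/L}\left[1-(1-2e^{-t/L})^2\right]^{\alpha-1/2}$. For a weight $w$, $\|u\|_{L^2_w([0,\infty))}=\left(\int_0^\infty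 |u|^2w\,dt\right)^{1/2}$, and $\|u\|_{L^\infty([0,\infty))}=\sup_{t\ge0}|u(t)|$. Functions $u$ are regarded as defined pointwise. $I_nu$ denotes the interpolant: the unique function in $\mathrm{span}\{\mathcal{G}_{i,0}^{\alpha,L},\dots,\mathcal{G}_{i,n}^{\alpha,L}\}$ with $I_nu({}_i^Lt_{n,j}^\alpha)=u({}_i^Lt_{n,j}^\alpha)$ for $j=0,\dots,n$. $a_n\lesssim b_n$ (nonnegative sequences): for every $\varepsilon>0$, $a_n\le(1+\varepsilon)b_n$ for all sufficiently large $n$. *)

theory Defs
  imports "HOL-Analysis.Analysis" "HOL-Computational_Algebra.Polynomial"
begin

definition gegenbauer_weight :: "real \<Rightarrow> real \<Rightarrow> real" where
  "gegenbauer_weight \<alpha> x = (1 - x\<^sup>2) powr (\<alpha> - 1/2)"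

text \<open>For \<open>\<alpha> > -1/2\<close> the weight is integrable on \<open>[-1,1]\<close>, so the Bochner integrals below are
  proper and the family exists and is unique.\<close>

definition gegenbauer :: "real \<Rightarrow> nat \<Rightarrow> real poly" where
  "gegenbauer \<alpha> = (THE G :: nat \<Rightarrow> real poly.
     (\<forall>k. degree (G k) = k \<and> poly (G k) 1 = 1) \<and>
     (\<forall>j k. j \<noteq> k \<longrightarrow>
        (LINT x:{-1..1}|lborel. poly (G j) x * poly (G k) x * gegenbauer_weight \<alpha> x) = 0))"

text \<open>The zeros \<open>x\<^sub>n\<^sub>,\<^sub>0 < \<dots> < x\<^sub>n\<^sub>,\<^sub>n\<close> of the polynomial of degree \<open>n + 1\<close>; they are real and
  simple for \<open>\<alpha> > -1/2\<close>.\<close>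

definition gegenbauer_zero :: "real \<Rightarrow> nat \<Rightarrow> nat \<Rightarrow> real" where
  "gegenbauer_zero \<alpha> n j = sorted_list_of_set {x. poly (gegenbauer \<alpha> (Suc n)) x = 0} ! j"

text \<open>The index \<open>i\<close> ranges over \<open>{1, 2}\<close>: \<open>1\<close> is the algebraic map, \<open>2\<close> the exponential one.\<close>

definition mapT :: "nat \<Rightarrow> real \<Rightarrow> real \<Rightarrow> real" where
  "mapT i L t = (if i = 1 then (t - L) / (t + L) else 1 - 2 * exp (- t / L))"

definition mapped_gegenbauer :: "nat \<Rightarrow> real \<Rightarrow> real \<Rightarrow> nat \<Rightarrow> real \<Rightarrow> real" where
  "mapped_gegenbauer i \<alpha> L k t = poly (gegenbauer \<alpha> k) (mapT i L t)"

definition mapped_node :: "nat \<Rightarrow> real \<Rightarrow> real \<Rightarrow> nat \<Rightarrow> nat \<Rightarrow> real" where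
  "mapped_node i \<alpha> L n j = the_inv_into {0..} (mapT i L) (gegenbauer_zero \<alpha> n j)"

definition mapped_weight :: "nat \<Rightarrow> real \<Rightarrow> real \<Rightarrow> real \<Rightarrow> real" where
  "mapped_weight i \<alpha> L t =
     (if i = 1
      then 4 powr \<alpha> * L powr (\<alpha> + 1/2) * t powr (\<alpha> - 1/2) / (t + L) powr (2 * \<alpha> + 1)
      else 2 / L * exp (- t / L) * (1 - (1 - 2 * exp (- t / L))\<^sup>2) powr (\<alpha> - 1/2))"

definition mapped_span :: "nat \<Rightarrow> real \<Rightarrow> real \<Rightarrow> nat \<Rightarrow> (real \<Rightarrow> real) set" where
  "mapped_span i \<alpha> L n = {f. \<exists>c. f = (\<lambda>t. \<Sum>k\<le>n. c k * mapped_gegenbauer i \<alpha> L k t)}"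

definition interpolant ::
  "nat \<Rightarrow> real \<Rightarrow> real \<Rightarrow> nat \<Rightarrow> (real \<Rightarrow> real) \<Rightarrow> real \<Rightarrow> real" where
  "interpolant i \<alpha> L n u =
     (THE f. f \<in> mapped_span i \<alpha> L n \<and>
        (\<forall>j\<le>n. f (mapped_node i \<alpha> L n j) = u (mapped_node i \<alpha> L n j)))"

text \<open>Norms on \<open>[0,\<infinity>)\<close> are extended-valued, so that a divergent integral or an unbounded function
  has norm \<open>\<infinity>\<close>.\<close>

definition wL2_integral :: "(real \<Rightarrow> real) \<Rightarrow> (real \<Rightarrow> real) \<Rightarrow> ennreal" where
  "wL2_integral w u = (\<integral>\<^sup>+ t. ennreal (\<bar>u t\<bar>\<^sup>2 * w t) \<partial>lebesgue_on {0..})"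

definition wL2_norm :: "(real \<Rightarrow> real) \<Rightarrow> (real \<Rightarrow> real) \<Rightarrow> ennreal" where
  "wL2_norm w u =
     (if wL2_integral w u = \<infinity> then \<infinity> else ennreal (sqrt (enn2real (wL2_integral w u))))"

definition wL2 :: "(real \<Rightarrow> real) \<Rightarrow> (real \<Rightarrow> real) set" where
  "wL2 w = {u \<in> borel_measurable (lebesgue_on {0..}). wL2_norm w u < \<infinity>}"

text \<open>A genuine (not essential) supremum: functions are defined pointwise.\<close>

definition sup_norm :: "(real \<Rightarrow> real) \<Rightarrow> ennreal" where
  "sup_norm u = (SUP t\<in>{0..}. ennreal \<bar>u t\<bar>)"

definition asymp_le :: "(nat \<Rightarrow> ennreal) \<Rightarrow> (nat \<Rightarrow> ennreal) \<Rightarrow> bool" (infix "\<lesssim>" 50) where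
  "a \<lesssim> b \<longleftrightarrow> (\<forall>\<epsilon>::real. \<epsilon> > 0 \<longrightarrow> (\<forall>\<^sub>F n in sequentially. a n \<le> ennreal (1 + \<epsilon>) * b n))"

end

theory Submission imports Defs begin

text \<open>
  In the variable \<open>x = mapT i L t\<close> the interpolant is the polynomial \<open>p\<close> of degree at most \<open>n\<close>
  that takes the values of \<open>u\<close> at the zeros of the Gegenbauer polynomial of degree \<open>n + 1\<close>, and the
  weighted norm on the half-line becomes the Gegenbauer-weighted norm on \<open>(-1, 1)\<close>
  (\<open>interpolant_is_polynomial\<close>, \<open>wL2_integral_mapped_poly\<close>). Since \<open>p\<^sup>2\<close> has degree at most
  \<open>2 * n\<close>, Gauss quadrature with these \<open>n + 1\<close> nodes integrates it exactly; the quadrature weights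
  are positive, so the integral is at most the squared sup norm of \<open>u\<close> times the total mass of the
  Gegenbauer weight (\<open>gauss_quadrature\<close>, \<open>interpolation_stability\<close>). For \<open>\<alpha> \<ge> 0\<close> this mass is at
  most the mass \<open>\<pi>\<close> of the Chebyshev weight (\<open>gegenbauer_mass_le_pi\<close>).

  The estimate therefore holds for every single \<open>n\<close> with the constant \<open>\<surd>\<pi>\<close>, and the asymptotic
  form follows.

  The existence, uniqueness and real simple zeros of orthogonal polynomials are developed for an
  arbitrary strictly positive linear functional on polynomials; they are needed already for the
  Gegenbauer polynomials, their zeros and the interpolant to be what their descriptions say.
\<close>

section \<open>Polynomial preliminaries\<close>

lemma graded_family_spans:
  fixes B :: "nat \<Rightarrow> real poly"
  assumes "\<And>k. k \<le> n \<Longrightarrow> B k \<noteq> 0 \<and> degree (B k) = k" and "degree q \<le> n"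
  shows "\<exists>c. q = (\<Sum>k\<le>n. smult (c k) (B k))"
  using assms
proof (induction n arbitrary: q)
  case 0
  then obtain a b where ab: "q = [:a:]" "B 0 = [:b:]" "b \<noteq> 0"
    using degree_eq_zeroE[of q] degree_eq_zeroE[of "B 0"] by (metis le_zero_eq order_refl pCons_0_0)
  then show ?case by (intro exI[of _ "\<lambda>_. a / b"]) simp
next
  case (Suc n)
  define a where "a = coeff q (Suc n) / lead_coeff (B (Suc n))"
  define r where "r = q - smult a (B (Suc n))"
  have B: "B (Suc n) \<noteq> 0" "degree (B (Suc n)) = Suc n" using Suc.prems(1) by auto
  have "degree r \<le> Suc n"
    unfolding r_def using B Suc.prems(2) by (intro degree_diff_le) auto
  moreover have "coeff r (Suc n) = 0"
    using B by (simp add: r_def a_def) (metis degree_0 leading_coeff_0_iff nat.discI)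
  ultimately have "degree r \<le> n"
    by (metis degree_0 eq_zero_or_degree_less le0 le_SucE leading_coeff_0_iff)
  then obtain c where c: "r = (\<Sum>k\<le>n. smult (c k) (B k))"
    using Suc.IH[of r] Suc.prems(1) by auto
  have "q = (\<Sum>k\<le>Suc n. smult ((c(Suc n := a)) k) (B k))"
    using c by (simp add: r_def algebra_simps)
  then show ?case by blast
qed

lemma degree_prod_linear_factors:
  fixes Z :: "real set"
  shows "finite Z \<Longrightarrow> degree (\<Prod>z\<in>Z. [:-z, 1:]) = card Z"
  by (subst degree_prod_eq_sum_degree) auto

text \<open>Newton's form of interpolation: a new node is accommodated by adding a multiple of the
  polynomial that vanishes at all the old ones.\<close>
lemma lagrange_interpolation:
  fixes Z :: "real set" and f :: "real \<Rightarrow> real"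
  assumes "finite Z" "Z \<noteq> {}"
  shows "\<exists>p. degree p < card Z \<and> (\<forall>z\<in>Z. poly p z = f z)"
  using assms
proof (induction rule: finite_ne_induct)
  case (singleton x)
  show ?case by (intro exI[of _ "[:f x:]"]) auto
next
  case (insert x Z)
  then obtain p where p: "degree p < card Z" "\<And>z. z \<in> Z \<Longrightarrow> poly p z = f z" by blast
  define w where "w = (\<Prod>z\<in>Z. [:-z, 1:])"
  define q where "q = p + smult ((f x - poly p x) / poly w x) w"
  have "degree w = card Z" using insert.hyps(1) by (simp add: w_def degree_prod_linear_factors)
  then have "degree q \<le> card Z" unfolding q_def using p(1)
    by (intro degree_add_le) (auto intro: order_trans[OF degree_smult_le])
  moreover have "poly w x \<noteq> 0" "\<And>z. z \<in> Z \<Longrightarrow> poly w z = 0"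
    using insert.hyps by (auto simp: w_def poly_prod)
  ultimately show ?case using insert.hyps p(2) by (intro exI[of _ q]) (auto simp: q_def)
qed

text \<open>The zeros of odd order are the right choice of \<open>Z\<close>, but orders need not be mentioned:
  splitting off one linear factor of \<open>p\<close> at a time, each zero found is toggled in or out of \<open>Z\<close>,
  so that the factor is either squared or absorbed. Once no zero is left in the interval, the
  intermediate value theorem fixes the sign.\<close>
lemma sign_balancing_zeros:
  fixes p :: "real poly"
  assumes "p \<noteq> 0"
  shows "\<exists>Z s. finite Z \<and> Z \<subseteq> {x \<in> {a<..<b}. poly p x = 0} \<and> s \<noteq> 0 \<and>
           (\<forall>x\<in>{a<..<b}. 0 \<le> s * poly (p * (\<Prod>z\<in>Z. [:-z, 1:])) x)"
  using assms
proof (induction "degree p" arbitrary: p rule: less_induct)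
  case less
  show ?case
  proof (cases "\<exists>c\<in>{a<..<b}. poly p c = 0")
    case False
    have same: "poly p x * poly p y > 0" if "x \<in> {a<..<b}" "y \<in> {a<..<b}" for x y
    proof (rule ccontr)
      assume neg: "\<not> 0 < poly p x * poly p y"
      moreover have nz: "poly p x \<noteq> 0" "poly p y \<noteq> 0" using False that by auto
      ultimately have neg: "poly p x * poly p y < 0" by (simp add: not_less order_less_le)
      then have "x \<noteq> y" by (auto simp: mult_less_0_iff)
      then consider "x < y" | "y < x" by linarith
      then obtain c where "poly p c = 0" "c \<in> {a<..<b}"
      proof cases
        case 1
        then show ?thesis using poly_IVT[OF 1 neg] that \<open>x \<in> _\<close> \<open>y \<in> _\<close> by force
      next
        case 2
        then show ?thesis
          using poly_IVT[OF 2, of p] neg that \<open>x \<in> _\<close> \<open>y \<in> _\<close> by (force simp: mult.commute)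
      qed
      then show False using False by auto
    qed
    show ?thesis
    proof (cases "a < b")
      case True
      then have m: "(a + b) / 2 \<in> {a<..<b}" by auto
      have "0 \<le> poly p ((a + b) / 2) * poly p x" if "x \<in> {a<..<b}" for x
        using same[OF m that] by simp
      then show ?thesis using False m
        by (intro exI[of _ "{}"] exI[of _ "poly p ((a + b) / 2)"]) auto
    qed (auto intro!: exI[of _ "{}"] exI[of _ 1])
  next
    case True
    then obtain c where c: "c \<in> {a<..<b}" "poly p c = 0" by blast
    then obtain q where q: "p = [:-c, 1:] * q" by (metis dvd_def poly_eq_0_iff_dvd)
    with less.prems have "q \<noteq> 0" by auto
    then have "degree q < degree p" by (subst q, subst degree_mult_eq) auto
    then obtain Z s where Z: "finite Z" "Z \<subseteq> {x \<in> {a<..<b}. poly q x = 0}" "s \<noteq> 0"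
      "\<And>x. x \<in> {a<..<b} \<Longrightarrow> 0 \<le> s * poly (q * (\<Prod>z\<in>Z. [:-z, 1:])) x"
      using less.hyps[OF _ \<open>q \<noteq> 0\<close>] by blast
    show ?thesis
    proof (cases "c \<in> Z")
      case True
      have "(\<Prod>z\<in>Z. [:-z, 1:]) = [:-c, 1:] * (\<Prod>z\<in>Z - {c}. [:-z, 1:])"
        using True Z(1) by (rule prod.remove[rotated])
      then have "p * (\<Prod>z\<in>Z - {c}. [:-z, 1:]) = q * (\<Prod>z\<in>Z. [:-z, 1:])"
        using q by (simp only: mult_ac)
      then show ?thesis using Z c by (intro exI[of _ "Z - {c}"] exI[of _ s]) (auto simp: q)
    next
      case False
      have "p * (\<Prod>z\<in>insert c Z. [:-z, 1:]) = [:-c, 1:]\<^sup>2 * (q * (\<Prod>z\<in>Z. [:-z, 1:]))"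
        unfolding prod.insert[OF Z(1) False] using q by (simp only: mult_ac power2_eq_square)
      then have "s * poly (p * (\<Prod>z\<in>insert c Z. [:-z, 1:])) x
          = (x - c)\<^sup>2 * (s * poly (q * (\<Prod>z\<in>Z. [:-z, 1:])) x)" for x
        by (simp only: poly_mult poly_power) (simp add: algebra_simps)
      then have "0 \<le> s * poly (p * (\<Prod>z\<in>insert c Z. [:-z, 1:])) x" if "x \<in> {a<..<b}" for x
        using Z(4)[OF that] by (simp only: mult_nonneg_nonneg zero_le_power2)
      moreover have "insert c Z \<subseteq> {x \<in> {a<..<b}. poly p x = 0}"
        using Z(2) c by (auto simp: q)
      ultimately show ?thesis using Z
        by (intro exI[of _ "insert c Z"] exI[of _ s]) blast
    qed
  qed
qed

section \<open>Orthogonal polynomials and Gauss quadrature for a positive functional\<close>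

text \<open>Integration against a weight enters the theory of orthogonal polynomials only through
  linearity and strict positivity.\<close>
locale positive_functional =
  fixes \<Lambda> :: "real poly \<Rightarrow> real" and a b :: real
  assumes add: "\<Lambda> (p + q) = \<Lambda> p + \<Lambda> q"
    and smult: "\<Lambda> (smult c p) = c * \<Lambda> p"
    and pos: "p \<noteq> 0 \<Longrightarrow> (\<And>x. x \<in> {a<..<b} \<Longrightarrow> 0 \<le> poly p x) \<Longrightarrow> 0 < \<Lambda> p"
begin

lemma zero [simp]: "\<Lambda> 0 = 0"
  using smult[of 0 0] by simp

lemma diff: "\<Lambda> (p - q) = \<Lambda> p - \<Lambda> q"
  using add[of "p - q" q] by simp

lemma sum: "\<Lambda> (\<Sum>i\<in>A. f i) = (\<Sum>i\<in>A. \<Lambda> (f i))"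
  by (induction A rule: infinite_finite_induct) (auto simp: add)

lemma square_pos: "p \<noteq> 0 \<Longrightarrow> 0 < \<Lambda> (p * p)"
  by (intro pos) auto

definition orthogonal_poly :: "nat \<Rightarrow> real poly \<Rightarrow> bool" where
  "orthogonal_poly n P \<longleftrightarrow>
     P \<noteq> 0 \<and> degree P = n \<and> (\<forall>q. degree q < n \<longrightarrow> \<Lambda> (P * q) = 0)"

lemma orthogonal_poly_pairwise:
  assumes P: "orthogonal_poly j P" and Q: "orthogonal_poly k Q" and "j \<noteq> k"
  shows "\<Lambda> (P * Q) = 0"
proof (cases "j < k")
  case True
  then have "\<Lambda> (Q * P) = 0" using P Q by (auto simp: orthogonal_poly_def)
  then show ?thesis by (simp add: mult.commute)
next
  case False
  then show ?thesis using assms by (auto simp: orthogonal_poly_def)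
qed

text \<open>Orthogonality to one polynomial of each smaller degree suffices, since these span.\<close>
lemma orthogonal_polyI:
  assumes "P \<noteq> 0" "degree P = n" "\<And>k. k < n \<Longrightarrow> B k \<noteq> 0 \<and> degree (B k) = k"
    and "\<And>k. k < n \<Longrightarrow> \<Lambda> (P * B k) = 0"
  shows "orthogonal_poly n P"
  unfolding orthogonal_poly_def
proof (intro conjI allI impI)
  fix q :: "real poly"
  assume "degree q < n"
  then obtain m where m: "n = Suc m" "degree q \<le> m" by (cases n) auto
  with assms(3) obtain c where "q = (\<Sum>k\<le>m. smult (c k) (B k))"
    using graded_family_spans[of m B q] by auto
  then show "\<Lambda> (P * q) = 0"
    using assms(4) m by (simp add: sum_distrib_left sum smult)
qed fact+

text \<open>The Gram--Schmidt step: subtract from \<open>x ^ n\<close> its projection onto the lower degrees.\<close>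
lemma orthogonal_poly_exists: "\<exists>P. orthogonal_poly n P"
proof (induction n rule: less_induct)
  case (less n)
  then obtain B where B: "\<And>k. k < n \<Longrightarrow> orthogonal_poly k (B k)" by metis
  have ortho: "\<Lambda> (B j * B k) = 0" if "j < n" "k < n" "j \<noteq> k" for j k
    using orthogonal_poly_pairwise B that by blast
  define S where "S = (\<Sum>k<n. smult (\<Lambda> (monom 1 n * B k) / \<Lambda> (B k * B k)) (B k))"
  define P where "P = monom 1 n - S"
  have S: "coeff S m = 0" if "n \<le> m" for m
    using B that by (auto simp: S_def coeff_sum orthogonal_poly_def intro!: sum.neutral coeff_eq_0)
  then have Pn: "coeff P n = 1" by (simp add: P_def)
  have "degree P \<le> n" using S by (intro degree_le) (auto simp: P_def)
  with Pn have deg: "degree P = n" by (metis le_degree order_antisym zero_neq_one)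
  have "\<Lambda> (P * B k) = 0" if "k < n" for k
  proof -
    have "\<Lambda> (S * B k) = (\<Sum>j<n. \<Lambda> (monom 1 n * B j) / \<Lambda> (B j * B j) * \<Lambda> (B j * B k))"
      by (simp add: S_def sum_distrib_right sum smult)
    also have "\<dots> = (\<Sum>j<n. if j = k then \<Lambda> (monom 1 n * B k) else 0)"
      using ortho[OF _ that] square_pos[of "B k"] B[OF that]
      by (intro sum.cong) (auto simp: orthogonal_poly_def)
    finally show ?thesis using that by (simp add: P_def left_diff_distrib diff)
  qed
  then have "orthogonal_poly n P"
    using deg Pn B by (intro orthogonal_polyI[of P n B]) (auto simp: orthogonal_poly_def)
  then show ?case ..
qed

text \<open>After matching leading coefficients, the difference has smaller degree and is orthogonal to
  itself; so orthogonality determines the polynomial up to a scalar, and its value at one point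
  fixes the scalar.\<close>
lemma orthogonal_poly_unique:
  assumes P: "orthogonal_poly n P" and Q: "orthogonal_poly n Q"
    and "poly P c = 1" "poly Q c = 1"
  shows "P = Q"
proof -
  define s where "s = lead_coeff Q / lead_coeff P"
  define D where "D = Q - smult s P"
  have PQ: "P \<noteq> 0" "degree P = n" "degree Q = n"
    using P Q by (auto simp: orthogonal_poly_def)
  have orth: "\<Lambda> (P * q) = 0" "\<Lambda> (Q * q) = 0" if "degree q < n" for q
    using P Q that by (auto simp: orthogonal_poly_def)
  have D: "D = 0"
  proof (rule ccontr)
    assume "D \<noteq> 0"
    have "degree D \<le> n" using PQ by (auto simp: D_def intro!: degree_diff_le)
    moreover have "coeff P n \<noteq> 0" using PQ leading_coeff_0_iff by blast
    then have "coeff D n = 0" using PQ by (simp add: D_def s_def)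
    ultimately have "degree D < n" using \<open>D \<noteq> 0\<close>
      by (metis leading_coeff_0_iff order_less_le)
    then have "\<Lambda> (D * D) = 0"
      using orth(1)[of D] orth(2)[of D]
      by (simp add: D_def left_diff_distrib diff smult)
    with square_pos[OF \<open>D \<noteq> 0\<close>] show False by simp
  qed
  then have "Q = smult s P" by (simp add: D_def)
  with assms(3,4) show ?thesis by simp
qed

text \<open>If a product of fewer than \<open>n\<close> linear factors made the sign of \<open>P\<close> constant, positivity of
  the functional would contradict the orthogonality of \<open>P\<close> to that product.\<close>
lemma zeros_in_interval:
  assumes P: "orthogonal_poly n P"
  shows "finite {x. poly P x = 0}" "card {x. poly P x = 0} = n" "{x. poly P x = 0} \<subseteq> {a<..<b}"
proof -
  have P0: "P \<noteq> 0" "degree P = n" using P by (auto simp: orthogonal_poly_def)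
  show fin: "finite {x. poly P x = 0}" using P0 poly_roots_finite by blast
  have ub: "card {x. poly P x = 0} \<le> n" using P0 card_poly_roots_bound by blast
  obtain Z s where Z: "finite Z" "Z \<subseteq> {x \<in> {a<..<b}. poly P x = 0}" "s \<noteq> 0"
      "\<And>x. x \<in> {a<..<b} \<Longrightarrow> 0 \<le> s * poly (P * (\<Prod>z\<in>Z. [:-z, 1:])) x"
    using sign_balancing_zeros[OF P0(1), of a b] by blast
  define q where "q = (\<Prod>z\<in>Z. [:-z, 1:])"
  have "q \<noteq> 0" using Z(1) by (auto simp: q_def)
  have dq: "degree q = card Z" using Z(1) by (simp add: q_def degree_prod_linear_factors)
  have "0 < \<Lambda> (smult s (P * q))"
    using Z(3,4) P0 \<open>q \<noteq> 0\<close> by (intro pos) (auto simp: q_def)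
  then have "\<Lambda> (P * q) \<noteq> 0" by (auto simp: smult)
  then have "n \<le> card Z" using P dq unfolding orthogonal_poly_def by (metis not_less)
  then have "Z = {x. poly P x = 0}"
    using Z(2) ub fin by (intro card_seteq) auto
  then show "card {x. poly P x = 0} = n" "{x. poly P x = 0} \<subseteq> {a<..<b}"
    using Z(2) ub \<open>n \<le> card Z\<close> by auto
qed

text \<open>This is why Gauss quadrature is exact up to degree \<open>2 * n - 1\<close>: such an \<open>r\<close> is \<open>P * q\<close> with
  \<open>q\<close> of degree less than \<open>n\<close>.\<close>
lemma vanishing_at_zeros:
  assumes P: "orthogonal_poly n P" and r: "degree r < 2 * n"
    and van: "\<And>z. poly P z = 0 \<Longrightarrow> poly r z = 0"
  shows "\<Lambda> r = 0"
proof -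
  note Z = zeros_in_interval[OF P]
  have P0: "P \<noteq> 0" "degree P = n" using P by (auto simp: orthogonal_poly_def)
  have "n > 0" using r by auto
  have eq: "r = P * (r div P) + r mod P" by simp
  have "poly (r mod P) z = 0" if "poly P z = 0" for z
    using van[OF that] that by (metis eq add_0 mult_zero_left poly_add poly_mult)
  moreover have "degree (r mod P) < n"
    using degree_mod_less[OF P0(1), of r] P0(2) \<open>n > 0\<close> by auto
  ultimately have "r mod P = 0"
    using Z by (intro poly_eqI_degree[of "{x. poly P x = 0}"]) auto
  with eq have eq: "r = P * (r div P)" by simp
  have "degree (r div P) < n"
  proof (cases "r div P = 0")
    case False
    then have "degree r = n + degree (r div P)"
      using P0 by (subst eq) (simp add: degree_mult_eq)
    then show ?thesis using r by simp
  qed (use \<open>n > 0\<close> in simp)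
  then show ?thesis using P by (subst eq) (auto simp: orthogonal_poly_def)
qed

text \<open>The weights are the values of the functional on the Lagrange basis polynomials \<open>l z\<close>. They
  are positive because \<open>l z\<close> and its square agree at all nodes, hence have the same value.\<close>
theorem gauss_quadrature:
  assumes P: "orthogonal_poly n P" and "n > 0"
  obtains \<omega> where "\<And>z. poly P z = 0 \<Longrightarrow> 0 < \<omega> z"
    and "\<And>r. degree r < 2 * n \<Longrightarrow> \<Lambda> r = (\<Sum>z | poly P z = 0. \<omega> z * poly r z)"
proof -
  define Z where "Z = {x. poly P x = 0}"
  have Z: "finite Z" "card Z = n" using zeros_in_interval[OF P] by (auto simp: Z_def)
  then have "Z \<noteq> {}" using \<open>n > 0\<close> by auto
  have "\<exists>p. degree p < n \<and> (\<forall>y\<in>Z. poly p y = (if y = z then 1 else 0))" for z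
    using lagrange_interpolation[OF Z(1) \<open>Z \<noteq> {}\<close>] Z(2) by simp
  then obtain l where l: "\<And>z. degree (l z) < n"
      "\<And>z y. y \<in> Z \<Longrightarrow> poly (l z) y = (if y = z then 1 else 0)" by metis
  have "0 < \<Lambda> (l z)" if "z \<in> Z" for z
  proof -
    have "degree (l z * l z - l z) < 2 * n"
      using l(1)[of z] degree_mult_le[of "l z" "l z"] by (intro degree_diff_less) auto
    then have "\<Lambda> (l z * l z - l z) = 0"
      using l(2) by (intro vanishing_at_zeros[OF P]) (auto simp: Z_def)
    moreover have "l z \<noteq> 0" using l(2)[OF that, of z] by auto
    ultimately show ?thesis using square_pos[of "l z"] by (simp add: diff)
  qed
  moreover have "\<Lambda> r = (\<Sum>z\<in>Z. \<Lambda> (l z) * poly r z)" if r: "degree r < 2 * n" for r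
  proof -
    define s where "s = (\<Sum>z\<in>Z. smult (poly r z) (l z))"
    have "degree s < 2 * n" unfolding s_def
      using l(1) \<open>n > 0\<close>
      by (intro degree_sum_less) (auto intro: le_less_trans[OF degree_smult_le] less_le_trans[OF l(1)])
    moreover have "poly s y = poly r y" if "y \<in> Z" for y
    proof -
      have "poly s y = (\<Sum>z\<in>Z. if y = z then poly r z else 0)"
        unfolding s_def poly_sum using l(2)[OF that] by (intro sum.cong) auto
      then show ?thesis using that Z(1) by simp
    qed
    ultimately have "\<Lambda> (r - s) = 0"
      using r by (intro vanishing_at_zeros[OF P]) (auto simp: Z_def intro: degree_diff_less)
    then show ?thesis by (simp add: diff s_def sum smult mult.commute)
  qed
  ultimately show thesis using that[of "\<lambda>z. \<Lambda> (l z)"] by (auto simp: Z_def)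
qed

text \<open>The square of \<open>p\<close> is still within the range of exactness, so its integral is a positive
  combination of the squared nodal values, with weights of total mass \<open>\<Lambda> 1\<close>.\<close>
lemma interpolation_stability:
  assumes P: "orthogonal_poly n P" and "degree p < n"
    and bound: "\<And>z. poly P z = 0 \<Longrightarrow> \<bar>poly p z\<bar> \<le> M"
  shows "\<Lambda> (p * p) \<le> M\<^sup>2 * \<Lambda> 1"
proof -
  have "n > 0" using assms(2) by auto
  obtain \<omega> where \<omega>: "\<And>z. poly P z = 0 \<Longrightarrow> 0 < \<omega> z"
      "\<And>r. degree r < 2 * n \<Longrightarrow> \<Lambda> r = (\<Sum>z | poly P z = 0. \<omega> z * poly r z)"
    using gauss_quadrature[OF P \<open>n > 0\<close>] by blast
  have "\<Lambda> (p * p) = (\<Sum>z | poly P z = 0. \<omega> z * (poly p z)\<^sup>2)"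
    using assms(2) degree_mult_le[of p p] by (subst \<omega>(2)) (auto simp: power2_eq_square)
  also have "\<dots> \<le> (\<Sum>z | poly P z = 0. \<omega> z * M\<^sup>2)"
    using \<omega>(1) power_mono[OF bound abs_ge_zero, of _ 2]
    by (intro sum_mono mult_left_mono) (auto intro: less_imp_le)
  also have "\<dots> = M\<^sup>2 * \<Lambda> 1"
    using \<open>n > 0\<close> by (subst \<omega>(2)) (auto simp: sum_distrib_left mult.commute)
  finally show ?thesis .
qed


lemma orthogonal_family_imp_orthogonal_poly:
  assumes "\<And>k. degree (G k) = k" "\<And>k. G k \<noteq> 0" "\<And>j k. j \<noteq> k \<Longrightarrow> \<Lambda> (G j * G k) = 0"
  shows "orthogonal_poly n (G n)"
  using assms by (intro orthogonal_polyI[of "G n" n G]) auto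

text \<open>Normalization at \<open>c\<close> is possible because all zeros lie inside the interval.\<close>
lemma ex1_normalized_orthogonal_family:
  assumes "c \<notin> {a<..<b}"
  shows "\<exists>!G. (\<forall>k. degree (G k) = k \<and> poly (G k) c = 1) \<and> (\<forall>j k. j \<noteq> k \<longrightarrow> \<Lambda> (G j * G k) = 0)"
proof (rule ex_ex1I)
  obtain P where P: "\<And>k. orthogonal_poly k (P k)" using orthogonal_poly_exists by metis
  have nz: "poly (P k) c \<noteq> 0" for k using zeros_in_interval(3)[OF P[of k]] assms by auto
  have "\<Lambda> (P j * P k) = 0" if "j \<noteq> k" for j k
    using orthogonal_poly_pairwise P that by blast
  then show "\<exists>G. (\<forall>k. degree (G k) = k \<and> poly (G k) c = 1) \<and>
      (\<forall>j k. j \<noteq> k \<longrightarrow> \<Lambda> (G j * G k) = 0)"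
    using P nz by (intro exI[of _ "\<lambda>k. smult (1 / poly (P k) c) (P k)"])
      (auto simp: orthogonal_poly_def smult)
next
  fix G H :: "nat \<Rightarrow> real poly"
  assume G: "(\<forall>k. degree (G k) = k \<and> poly (G k) c = 1) \<and> (\<forall>j k. j \<noteq> k \<longrightarrow> \<Lambda> (G j * G k) = 0)"
    and H: "(\<forall>k. degree (H k) = k \<and> poly (H k) c = 1) \<and> (\<forall>j k. j \<noteq> k \<longrightarrow> \<Lambda> (H j * H k) = 0)"
  have "G k \<noteq> 0" "H k \<noteq> 0" for k using G H by (metis poly_0 zero_neq_one)+
  with G H have "orthogonal_poly n (G n)" "orthogonal_poly n (H n)" for n
    by (auto intro!: orthogonal_family_imp_orthogonal_poly)
  with G H show "G = H" by (intro ext orthogonal_poly_unique) auto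
qed

end

section \<open>The Gegenbauer weight\<close>

definition gegenbauer_functional :: "real \<Rightarrow> real poly \<Rightarrow> real" where
  "gegenbauer_functional \<alpha> p = (LINT x:{-1<..<1}|lborel. poly p x * gegenbauer_weight \<alpha> x)"

lemma chebyshev_weight_integral:
  "set_integrable lborel {-1<..<1::real} (\<lambda>x. inverse (sqrt (1 - x\<^sup>2)))"
  "(LINT x:{-1<..<1::real}|lborel. inverse (sqrt (1 - x\<^sup>2))) = pi"
proof -
  have sq: "x\<^sup>2 < 1" if "-1 < x" "x < 1" for x :: real
    using that by (simp add: abs_square_less_1)
  have cont: "continuous_on {-1..1} arcsin" by (intro continuous_intros) auto
  have A: "(arcsin \<longlongrightarrow> - (pi / 2)) (at_right (-1))"
    using cont[unfolded continuous_on_def, rule_format, of "-1"] by (simp add: at_within_Icc_at_right)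
  have B: "(arcsin \<longlongrightarrow> pi / 2) (at_left 1)"
    using cont[unfolded continuous_on_def, rule_format, of 1] by (simp add: at_within_Icc_at_left)
  have iv: "einterval (ereal (-1)) (ereal 1) = {-1<..<1}"
    by (auto simp: einterval_def)
  note FTC = interval_integral_FTC_nonneg[of "ereal (-1)" "ereal 1" arcsin
      "\<lambda>x. inverse (sqrt (1 - x\<^sup>2))" "- (pi / 2)" "pi / 2"]
  have int: "set_integrable lborel (einterval (ereal (-1)) (ereal 1)) (\<lambda>x. inverse (sqrt (1 - x\<^sup>2)))"
    "(LBINT x=ereal (-1)..ereal 1. inverse (sqrt (1 - x\<^sup>2))) = pi / 2 - - (pi / 2)"
    by (rule FTC; use A B sq in \<open>auto simp del: uminus_ereal.simps
        simp: ereal_tendsto_simps less_imp_neq[OF sq] less_imp_le[OF sq] intro!: DERIV_arcsin continuous_intros\<close>)+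
  show "set_integrable lborel {-1<..<1::real} (\<lambda>x. inverse (sqrt (1 - x\<^sup>2)))"
    using int(1) unfolding iv .
  show "(LINT x:{-1<..<1::real}|lborel. inverse (sqrt (1 - x\<^sup>2))) = pi"
    using int(2) unfolding interval_lebesgue_integral_def iv by simp
qed

text \<open>The base is at most \<open>1\<close>, so powers decrease in the exponent: the Chebyshev weight
  (\<open>\<alpha> = 0\<close>) dominates the weights of all \<open>\<alpha> \<ge> 0\<close>. It thereby gives both their integrability
  and the bound \<open>\<pi>\<close> on their total mass.\<close>
lemma gegenbauer_weight_bound:
  assumes "\<alpha> \<ge> 0" "-1 < x" "x < 1"
  shows "gegenbauer_weight \<alpha> x \<le> inverse (sqrt (1 - x\<^sup>2))"
proof -
  have pos: "0 < 1 - x\<^sup>2" using assms by (simp add: abs_square_less_1)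
  have "(1 - x\<^sup>2) powr (\<alpha> - 1/2) \<le> (1 - x\<^sup>2) powr (- (1/2))"
    using pos assms(1) by (intro powr_mono') auto
  then show ?thesis using pos by (simp add: gegenbauer_weight_def powr_minus powr_half_sqrt)
qed

lemma gegenbauer_weight_nonneg: "0 \<le> gegenbauer_weight \<alpha> x"
  by (simp add: gegenbauer_weight_def)

lemma borel_measurable_poly [measurable]: "(\<lambda>x::real. poly p x) \<in> borel_measurable borel"
  by (intro borel_measurable_continuous_onI continuous_intros)

lemma borel_measurable_gegenbauer_weight [measurable]:
  "gegenbauer_weight \<alpha> \<in> borel_measurable borel"
  unfolding gegenbauer_weight_def by measurable

lemma gegenbauer_integrable:
  assumes "\<alpha> \<ge> 0"
  shows "set_integrable lborel {-1<..<1} (\<lambda>x. poly p x * gegenbauer_weight \<alpha> x)"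
proof -
  have "compact (poly p ` {-1..1})" by (intro compact_continuous_image continuous_intros) auto
  then obtain C where C: "\<And>x. x \<in> {-1..1} \<Longrightarrow> \<bar>poly p x\<bar> \<le> C"
    using compact_imp_bounded bounded_iff by (metis imageI real_norm_def)
  show ?thesis
  proof (rule set_integrable_bound)
    show "set_integrable lborel {-1<..<1::real} (\<lambda>x. C * inverse (sqrt (1 - x\<^sup>2)))"
      using chebyshev_weight_integral(1) by (intro set_integrable_mult_right) auto
    show "set_borel_measurable lborel {-1<..<1} (\<lambda>x. poly p x * gegenbauer_weight \<alpha> x)"
      unfolding set_borel_measurable_def by measurable
    show "AE x in lborel. x \<in> {-1<..<1} \<longrightarrow>
        norm (poly p x * gegenbauer_weight \<alpha> x) \<le> norm (C * inverse (sqrt (1 - x\<^sup>2)))"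
    proof (intro AE_I2 impI)
      fix x :: real assume x: "x \<in> {-1<..<1}"
      have "\<bar>poly p x\<bar> * gegenbauer_weight \<alpha> x \<le> C * inverse (sqrt (1 - x\<^sup>2))"
        using C[of x] x gegenbauer_weight_bound[OF assms, of x] gegenbauer_weight_nonneg[of \<alpha> x]
        by (intro mult_mono) auto
      also have "\<dots> \<le> norm (C * inverse (sqrt (1 - x\<^sup>2)))"
        unfolding real_norm_def by (rule abs_ge_self)
      finally show "norm (poly p x * gegenbauer_weight \<alpha> x) \<le> norm (C * inverse (sqrt (1 - x\<^sup>2)))"
        using gegenbauer_weight_nonneg[of \<alpha> x] by (simp add: abs_mult)
    qed
  qed
qed

lemma positive_functional_gegenbauer:
  assumes "\<alpha> \<ge> 0"
  shows "positive_functional (gegenbauer_functional \<alpha>) (-1) 1"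
proof
  fix p q :: "real poly" and c :: real
  show "gegenbauer_functional \<alpha> (p + q) = gegenbauer_functional \<alpha> p + gegenbauer_functional \<alpha> q"
    using gegenbauer_integrable[OF assms]
    by (simp add: gegenbauer_functional_def distrib_right set_integral_add)
  show "gegenbauer_functional \<alpha> (smult c p) = c * gegenbauer_functional \<alpha> p"
    by (simp add: gegenbauer_functional_def mult.assoc)
next
  fix p :: "real poly"
  assume p: "p \<noteq> 0" "\<And>x. x \<in> {-1<..<1} \<Longrightarrow> 0 \<le> poly p x"
  let ?f = "\<lambda>x. indicator {-1<..<1} x *\<^sub>R (poly p x * gegenbauer_weight \<alpha> x)"
  have int: "integrable lborel ?f"
    using gegenbauer_integrable[OF assms] by (simp add: set_integrable_def)
  have nn: "0 \<le> ?f x" for x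
    using p(2) gegenbauer_weight_nonneg by (auto simp: indicator_def)
  have "integral\<^sup>L lborel ?f \<noteq> 0"
  proof
    assume "integral\<^sup>L lborel ?f = 0"
    then have "AE x in lborel. ?f x = 0"
      using integral_nonneg_eq_0_iff_AE[OF int] nn by simp
    moreover have "AE x in lborel. x \<notin> {x. poly p x = 0}"
      using p(1) by (intro AE_not_in finite_imp_null_set_lborel poly_roots_finite)
    ultimately have "AE x in lborel. x \<notin> {-1<..<1::real}"
    proof eventually_elim
      case (elim x)
      show ?case
      proof
        assume x: "x \<in> {-1<..<1}"
        then have "x\<^sup>2 < 1" by (simp add: abs_square_less_1 abs_less_iff)
        then have "gegenbauer_weight \<alpha> x > 0" by (simp add: gegenbauer_weight_def)
        with elim x show False by simp
      qed
    qed
    then have "{-1<..<1::real} \<in> null_sets lborel"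
      by (subst AE_iff_null_sets) auto
    then show False by (simp add: null_sets_def)
  qed
  moreover have "0 \<le> integral\<^sup>L lborel ?f" using nn by (intro Bochner_Integration.integral_nonneg) auto
  ultimately show "0 < gegenbauer_functional \<alpha> p"
    by (simp add: gegenbauer_functional_def set_lebesgue_integral_def)
qed

lemma gegenbauer_mass_le_pi:
  assumes "\<alpha> \<ge> 0"
  shows "gegenbauer_functional \<alpha> 1 \<le> pi"
proof -
  have "gegenbauer_functional \<alpha> 1 \<le> (LINT x:{-1<..<1::real}|lborel. inverse (sqrt (1 - x\<^sup>2)))"
    unfolding gegenbauer_functional_def
    using gegenbauer_weight_bound[OF assms] gegenbauer_integrable[OF assms, of 1] chebyshev_weight_integral(1)
    by (intro set_integral_mono) auto
  then show ?thesis by (simp add: chebyshev_weight_integral)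
qed

text \<open>The endpoints are harmless even pointwise, as \<open>0 powr (\<alpha> - 1/2) = 0\<close>.\<close>
lemma gegenbauer_functional_closed_interval:
  "gegenbauer_functional \<alpha> p = (LINT x:{-1..1}|lborel. poly p x * gegenbauer_weight \<alpha> x)"
  unfolding gegenbauer_functional_def set_lebesgue_integral_def
proof (intro Bochner_Integration.integral_cong refl)
  fix x :: real
  show "indicator {-1<..<1} x *\<^sub>R (poly p x * gegenbauer_weight \<alpha> x)
      = indicator {-1..1} x *\<^sub>R (poly p x * gegenbauer_weight \<alpha> x)"
    by (cases "x = 1 \<or> x = -1") (auto simp: indicator_def gegenbauer_weight_def)
qed

text \<open>The definite description that defines the Gegenbauer family denotes, because a normalized
  orthogonal family exists and is unique.\<close>
lemma gegenbauer_orthogonal: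
  assumes "\<alpha> \<ge> 0"
  shows "degree (gegenbauer \<alpha> k) = k" "gegenbauer \<alpha> k \<noteq> 0"
    and "positive_functional.orthogonal_poly (gegenbauer_functional \<alpha>) n (gegenbauer \<alpha> n)"
proof -
  interpret positive_functional "gegenbauer_functional \<alpha>" "-1" 1
    using assms by (rule positive_functional_gegenbauer)
  have "1 \<notin> {-1<..<1::real}" by simp
  note ex = ex1_normalized_orthogonal_family
    [OF this, unfolded gegenbauer_functional_closed_interval poly_mult]
  have G: "(\<forall>k. degree (gegenbauer \<alpha> k) = k \<and> poly (gegenbauer \<alpha> k) 1 = 1) \<and>
      (\<forall>j k. j \<noteq> k \<longrightarrow> gegenbauer_functional \<alpha> (gegenbauer \<alpha> j * gegenbauer \<alpha> k) = 0)"
    using theI'[OF ex] unfolding gegenbauer_def[symmetric] gegenbauer_functional_closed_interval poly_mult .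
  then show "degree (gegenbauer \<alpha> k) = k" for k by simp
  show nz: "gegenbauer \<alpha> k \<noteq> 0" for k using G by (metis poly_0 zero_neq_one)
  show "orthogonal_poly n (gegenbauer \<alpha> n)"
    using G nz by (intro orthogonal_family_imp_orthogonal_poly) auto
qed

section \<open>Transfer to the half-line\<close>

lemma mapT_inj:
  assumes "L > 0" "i \<in> {1, 2}"
  shows "inj_on (mapT i L) {0..}"
proof (rule inj_onI)
  fix s t assume "s \<in> {0..}" "t \<in> {0..}" "mapT i L s = mapT i L t"
  then show "s = t" using assms
    by (auto simp: mapT_def field_simps split: if_splits)
qed

lemma mapT_image:
  assumes "L > 0" "i \<in> {1, 2}"
  shows "mapT i L ` {0<..} = {-1<..<1}"
proof (intro equalityI subsetI)
  fix x assume "x \<in> mapT i L ` {0<..}"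
  then show "x \<in> {-1<..<1}" using assms by (auto simp: mapT_def field_simps)
next
  fix x :: real assume x: "x \<in> {-1<..<1}"
  show "x \<in> mapT i L ` {0<..}"
  proof (cases "i = 1")
    case True
    have "0 < L * (1 + x) / (1 - x)" using x assms by simp
    moreover have "mapT i L (L * (1 + x) / (1 - x)) = x"
      using x assms True by (simp add: mapT_def divide_simps) (simp add: algebra_simps)
    ultimately show ?thesis by (metis greaterThan_iff imageI)
  next
    case False
    with x assms show ?thesis
      by (intro image_eqI[of _ _ "- L * ln ((1 - x) / 2)"])
        (auto simp: mapT_def mult_less_0_iff diff_divide_distrib)
  qed
qed

definition mapT_deriv :: "nat \<Rightarrow> real \<Rightarrow> real \<Rightarrow> real" where
  "mapT_deriv i L t = (if i = 1 then 2 * L / (t + L)\<^sup>2 else 2 / L * exp (- t / L))"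

lemma mapT_deriv_nonneg: "L > 0 \<Longrightarrow> 0 \<le> mapT_deriv i L t"
  by (simp add: mapT_deriv_def)

lemma mapT_has_derivative:
  assumes "L > 0" "t > 0"
  shows "(mapT i L has_real_derivative mapT_deriv i L t) (at t within S)"
proof (cases "i = 1")
  case True
  then have T: "mapT i L = (\<lambda>t. (t - L) / (t + L))" by (auto simp: mapT_def)
  have "t + L \<noteq> 0" using assms by simp
  then show ?thesis unfolding T using True
    by (auto intro!: derivative_eq_intros simp: mapT_deriv_def power2_eq_square)
next
  case False
  then have T: "mapT i L = (\<lambda>t. 1 - 2 * exp (- t / L))" by (auto simp: mapT_def)
  show ?thesis unfolding T using False assms
    by (auto intro!: derivative_eq_intros simp: mapT_deriv_def)
qed

text \<open>The mapped weights are the ones for which composition with the map is an isometry. For the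
  algebraic map, both sides are written as exponentials of linear combinations of \<open>ln 2\<close>, \<open>ln L\<close>,
  \<open>ln t\<close> and \<open>ln (t + L)\<close>, whose coefficients are then compared.\<close>
lemma mapped_weight_eq:
  assumes "L > 0" "t > 0"
  shows "mapped_weight i \<alpha> L t = mapT_deriv i L t * gegenbauer_weight \<alpha> (mapT i L t)"
proof (cases "i = 1")
  case True
  have e: "x powr a = exp (a * ln x)" if "x > 0" for x a :: real
    using that by (simp add: powr_def)
  have ln4: "ln 4 = 2 * ln (2::real)" using ln_realpow[of 2 2] by simp
  have tL: "t + L > 0" using assms by simp
  have "1 - (mapT i L t)\<^sup>2 = 4 * L * t / (t + L)\<^sup>2"
    using True tL by (simp add: mapT_def power_divide diff_divide_eq_iff)
      (simp add: power2_eq_square algebra_simps)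
  moreover have "4 * L * t / (t + L)\<^sup>2 > 0" using assms by auto
  ultimately have w: "gegenbauer_weight \<alpha> (mapT i L t)
      = exp ((\<alpha> - 1/2) * (2 * ln 2 + ln L + ln t - 2 * ln (t + L)))"
    using assms tL by (simp add: gegenbauer_weight_def e ln_mult ln_div ln_realpow ln4)
  have D: "2 * L / (t + L)\<^sup>2 = exp (ln 2 + ln L - 2 * ln (t + L))"
    using assms tL by (simp add: exp_add exp_diff exp_double)
  have "mapped_weight i \<alpha> L t
      = exp (\<alpha> * (2 * ln 2)) * exp ((\<alpha> + 1/2) * ln L) * exp ((\<alpha> - 1/2) * ln t)
        / exp ((2 * \<alpha> + 1) * ln (t + L))"
    using True assms tL by (simp add: mapped_weight_def e ln4)
  also have "\<dots> = exp (\<alpha> * (2 * ln 2) + (\<alpha> + 1/2) * ln L + (\<alpha> - 1/2) * ln t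
        - (2 * \<alpha> + 1) * ln (t + L))"
    by (simp only: exp_add exp_diff)
  also have "\<dots> = 2 * L / (t + L)\<^sup>2 * gegenbauer_weight \<alpha> (mapT i L t)"
    unfolding w D exp_add[symmetric] by (rule arg_cong[of _ _ exp]) (simp add: algebra_simps)
  finally show ?thesis using True by (simp add: mapT_deriv_def)
qed (simp add: mapped_weight_def gegenbauer_weight_def mapT_def mapT_deriv_def)

lemma wL2_integral_mapped_poly:
  assumes "\<alpha> \<ge> 0" "L > 0" "i \<in> {1, 2}"
  shows "wL2_integral (mapped_weight i \<alpha> L) (\<lambda>t. poly p (mapT i L t))
    = ennreal (gegenbauer_functional \<alpha> (p * p))"
proof -
  let ?T = "mapT i L"
  let ?f = "\<lambda>x. poly (p * p) x * gegenbauer_weight \<alpha> x"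
  let ?h = "\<lambda>t. \<bar>poly p (?T t)\<bar>\<^sup>2 * mapped_weight i \<alpha> L t"
  let ?D = "mapT_deriv i L"
  have h: "\<bar>?D t\<bar> *\<^sub>R ?f (?T t) = ?h t" if "t \<in> {0<..}" for t
    using that mapT_deriv_nonneg[OF assms(2)]
    by (simp add: mapped_weight_eq assms(2) power2_eq_square mult_ac)
  have int: "set_integrable lborel {-1<..<1} ?f" by (rule gegenbauer_integrable[OF assms(1)])
  then have f: "?f absolutely_integrable_on {-1<..<1}"
    "integral {-1<..<1} ?f = gegenbauer_functional \<alpha> (p * p)"
    using set_borel_integral_eq_integral(2)[OF int]
    by (auto simp: gegenbauer_functional_def set_integrable_def intro: integrable_completion[THEN iffD2])
  have "(\<lambda>t. \<bar>?D t\<bar> *\<^sub>R ?f (?T t)) absolutely_integrable_on {0<..} \<and>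
      integral {0<..} (\<lambda>t. \<bar>?D t\<bar> *\<^sub>R ?f (?T t)) = gegenbauer_functional \<alpha> (p * p)"
    unfolding real_scaleR_def
    using f mapT_image[OF assms(2,3)]
    by (subst has_absolute_integral_change_of_variables_1')
      (auto intro: mapT_has_derivative[OF assms(2)] inj_on_subset[OF mapT_inj[OF assms(2,3)]])
  moreover have "(\<lambda>t. \<bar>?D t\<bar> *\<^sub>R ?f (?T t)) absolutely_integrable_on {0<..}
      \<longleftrightarrow> ?h absolutely_integrable_on {0<..}"
    "integral {0<..} (\<lambda>t. \<bar>?D t\<bar> *\<^sub>R ?f (?T t)) = integral {0<..} ?h"
    by (rule set_integrable_cong[OF refl refl h] Henstock_Kurzweil_Integration.integral_cong[OF h];
      assumption)+
  ultimately have hint: "?h absolutely_integrable_on {0<..}"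
      "integral {0<..} ?h = gegenbauer_functional \<alpha> (p * p)"
    by (simp_all only:)
  have "wL2_integral (mapped_weight i \<alpha> L) (\<lambda>t. poly p (?T t))
      = (\<integral>\<^sup>+ t. ennreal (?h t) * indicator {0..} t \<partial>lebesgue)"
    unfolding wL2_integral_def by (subst nn_integral_restrict_space) auto
  also have "\<dots> = (\<integral>\<^sup>+ t. ennreal (indicator {0<..} t *\<^sub>R ?h t) \<partial>lebesgue)"
  proof (rule nn_integral_cong_AE)
    have "AE t in lebesgue. t \<notin> {0::real}" by (rule AE_not_in) auto
    then show "AE t in lebesgue. ennreal (?h t) * indicator {0..} t = ennreal (indicator {0<..} t *\<^sub>R ?h t)"
      by eventually_elim (auto simp: indicator_def)
  qed
  also have "\<dots> = ennreal (LINT t:{0<..}|lebesgue. ?h t)"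
    unfolding set_lebesgue_integral_def
  proof (rule nn_integral_eq_integral)
    show "integrable lebesgue (\<lambda>t. indicator {0<..} t *\<^sub>R ?h t)"
      using hint(1) by (simp add: set_integrable_def)
    show "AE t in lebesgue. 0 \<le> indicator {0<..} t *\<^sub>R ?h t"
      using assms(2) by (auto simp: indicator_def mapped_weight_def)
  qed
  also have "\<dots> = ennreal (gegenbauer_functional \<alpha> (p * p))"
    using hint set_lebesgue_integral_eq_integral(2) by metis
  finally show ?thesis .
qed

lemma mapped_nodes_are_preimages:
  assumes "\<alpha> \<ge> 0" "L > 0" "i \<in> {1, 2}"
  shows "mapped_node i \<alpha> L n ` {..n} \<subseteq> {0..}"
    and "(\<lambda>j. mapT i L (mapped_node i \<alpha> L n j)) ` {..n} = {x. poly (gegenbauer \<alpha> (Suc n)) x = 0}"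
proof -
  interpret positive_functional "gegenbauer_functional \<alpha>" "-1" 1
    using assms(1) by (rule positive_functional_gegenbauer)
  let ?Z = "{x. poly (gegenbauer \<alpha> (Suc n)) x = 0}"
  note Z = zeros_in_interval[OF gegenbauer_orthogonal(3)[OF assms(1), of "Suc n"]]
  have "gegenbauer_zero \<alpha> n ` {..n} = (!) (sorted_list_of_set ?Z) ` {..<length (sorted_list_of_set ?Z)}"
    using Z by (simp add: gegenbauer_zero_def lessThan_Suc_atMost image_def)
  also have "\<dots> = set (sorted_list_of_set ?Z)"
    by (auto simp: set_conv_nth image_def)
  finally have zero: "gegenbauer_zero \<alpha> n ` {..n} = ?Z" using Z by simp
  have "mapped_node i \<alpha> L n j \<in> {0..} \<and> mapT i L (mapped_node i \<alpha> L n j) = gegenbauer_zero \<alpha> n j"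
    if "j \<le> n" for j
  proof -
    have "gegenbauer_zero \<alpha> n j \<in> mapT i L ` {0<..}"
      using zero Z(3) that mapT_image[OF assms(2,3)] by blast
    then have "gegenbauer_zero \<alpha> n j \<in> mapT i L ` {0..}" by force
    note x = mapT_inj[OF assms(2,3)] this
    show ?thesis
      unfolding mapped_node_def using the_inv_into_into[OF x subset_refl] f_the_inv_into_f[OF x] by simp
  qed
  then show "mapped_node i \<alpha> L n ` {..n} \<subseteq> {0..}"
    and "(\<lambda>j. mapT i L (mapped_node i \<alpha> L n j)) ` {..n} = ?Z"
    using zero by (auto simp: image_def)
qed

lemma mapped_span_eq:
  assumes "\<alpha> \<ge> 0"
  shows "mapped_span i \<alpha> L n = {f. \<exists>p. degree p \<le> n \<and> f = (\<lambda>t. poly p (mapT i L t))}"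
proof -
  have comb: "(\<Sum>k\<le>n. c k * mapped_gegenbauer i \<alpha> L k t)
      = poly (\<Sum>k\<le>n. smult (c k) (gegenbauer \<alpha> k)) (mapT i L t)" for c t
    by (simp add: mapped_gegenbauer_def poly_sum)
  have "degree (\<Sum>k\<le>n. smult (c k) (gegenbauer \<alpha> k)) \<le> n" for c
    using gegenbauer_orthogonal(1)[OF assms] by (intro degree_sum_le) (auto intro: order_trans[OF degree_smult_le])
  moreover have "\<exists>c. p = (\<Sum>k\<le>n. smult (c k) (gegenbauer \<alpha> k))" if "degree p \<le> n" for p
    using gegenbauer_orthogonal[OF assms] that by (intro graded_family_spans) auto
  ultimately show ?thesis unfolding mapped_span_def comb by blast
qed

text \<open>In the variable \<open>mapT i L t\<close> the interpolant is the ordinary polynomial interpolant at the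
  Gegenbauer zeros, so the definite description defining it denotes as well. Of its nodal values,
  only that they are values of \<open>u\<close> on the half-line is relevant for the sup norm.\<close>
lemma interpolant_is_polynomial:
  assumes "\<alpha> \<ge> 0" "L > 0" "i \<in> {1, 2}"
  obtains p where "degree p \<le> n" "interpolant i \<alpha> L n u = (\<lambda>t. poly p (mapT i L t))"
    and "\<And>z. poly (gegenbauer \<alpha> (Suc n)) z = 0 \<Longrightarrow> \<exists>t\<ge>0. poly p z = u t"
proof -
  interpret positive_functional "gegenbauer_functional \<alpha>" "-1" 1
    using assms(1) by (rule positive_functional_gegenbauer)
  let ?Z = "{x. poly (gegenbauer \<alpha> (Suc n)) x = 0}"
  note Z = zeros_in_interval[OF gegenbauer_orthogonal(3)[OF assms(1), of "Suc n"]]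
  note node = mapped_nodes_are_preimages[OF assms, of n]
  define v where "v z = u (the_inv_into {0..} (mapT i L) z)" for z
  have v: "v (mapT i L t) = u t" if "t \<ge> 0" for t
    using the_inv_into_f_f[OF mapT_inj[OF assms(2,3)]] that by (simp add: v_def)
  have cond: "(\<forall>j\<le>n. poly q (mapT i L (mapped_node i \<alpha> L n j)) = u (mapped_node i \<alpha> L n j))
      \<longleftrightarrow> (\<forall>z\<in>?Z. poly q z = v z)" for q
    unfolding node(2)[symmetric] using node(1) by (auto simp: image_subset_iff v)
  obtain p where p: "degree p \<le> n" "\<forall>z\<in>?Z. poly p z = v z"
    using lagrange_interpolation[OF Z(1), of v] Z(2) by (metis card.empty less_Suc_eq_le nat.distinct(1))
  have "interpolant i \<alpha> L n u = (\<lambda>t. poly p (mapT i L t))"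
    unfolding interpolant_def mapped_span_eq[OF assms(1)]
  proof (rule the_equality)
    fix f assume "f \<in> {f. \<exists>p. degree p \<le> n \<and> f = (\<lambda>t. poly p (mapT i L t))} \<and>
      (\<forall>j\<le>n. f (mapped_node i \<alpha> L n j) = u (mapped_node i \<alpha> L n j))"
    then obtain q where q: "degree q \<le> n" "f = (\<lambda>t. poly q (mapT i L t))"
      "\<forall>z\<in>?Z. poly q z = v z" using cond by blast
    have "q = p" using p q Z by (intro poly_eqI_degree[of ?Z]) auto
    with q show "f = (\<lambda>t. poly p (mapT i L t))" by simp
  qed (use p cond in blast)
  moreover have "\<exists>t\<ge>0. poly p z = u t" if "z \<in> ?Z" for z
  proof -
    from that obtain j where j: "j \<le> n" "z = mapT i L (mapped_node i \<alpha> L n j)"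
      unfolding node(2)[symmetric] by auto
    moreover have "mapped_node i \<alpha> L n j \<ge> 0" using node(1) j(1) by auto
    ultimately show ?thesis using that p(2) v by metis
  qed
  ultimately show thesis using p that by blast
qed

section \<open>Stability of mapped Gegenbauer interpolation\<close>

theorem theoremB1:
  fixes \<alpha> L :: real and i :: nat and u :: "real \<Rightarrow> real"
  assumes "\<alpha> \<ge> 0" and "L > 0" and "i \<in> {1, 2}"
    and "u \<in> wL2 (mapped_weight i \<alpha> L)"
  shows "(\<lambda>n. wL2_norm (mapped_weight i \<alpha> L) (interpolant i \<alpha> L n u))
           \<lesssim> (\<lambda>n. ennreal (sqrt pi) * sup_norm u)"
proof -
  interpret positive_functional "gegenbauer_functional \<alpha>" "-1" 1
    using assms(1) by (rule positive_functional_gegenbauer)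
  have main: "wL2_norm (mapped_weight i \<alpha> L) (interpolant i \<alpha> L n u) \<le> ennreal (sqrt pi) * sup_norm u" for n
  proof (cases "sup_norm u" rule: ennreal_cases)
    case top
    then show ?thesis by (simp add: ennreal_mult_top)
  next
    case (real M)
    have M: "\<bar>u t\<bar> \<le> M" if "t \<ge> 0" for t
    proof -
      have "ennreal \<bar>u t\<bar> \<le> sup_norm u" unfolding sup_norm_def using that by (intro SUP_upper) auto
      then show ?thesis using real by simp
    qed
    obtain p where p: "degree p \<le> n" "interpolant i \<alpha> L n u = (\<lambda>t. poly p (mapT i L t))"
      "\<And>z. poly (gegenbauer \<alpha> (Suc n)) z = 0 \<Longrightarrow> \<exists>t\<ge>0. poly p z = u t"
      using interpolant_is_polynomial[OF assms(1-3)] by blast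
    have "gegenbauer_functional \<alpha> (p * p) \<le> M\<^sup>2 * gegenbauer_functional \<alpha> 1"
      using p M by (intro interpolation_stability[OF gegenbauer_orthogonal(3)[OF assms(1), of "Suc n"]]) force+
    also have "\<dots> \<le> M\<^sup>2 * pi"
      using gegenbauer_mass_le_pi[OF assms(1)] by (intro mult_left_mono) auto
    finally have le: "gegenbauer_functional \<alpha> (p * p) \<le> M\<^sup>2 * pi" .
    have nn: "0 \<le> gegenbauer_functional \<alpha> (p * p)"
      using square_pos[of p] by (cases "p = 0") auto
    have "wL2_norm (mapped_weight i \<alpha> L) (interpolant i \<alpha> L n u)
        = ennreal (sqrt (gegenbauer_functional \<alpha> (p * p)))"
      using nn by (simp add: wL2_norm_def p(2) wL2_integral_mapped_poly[OF assms(1-3)])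
    also have "\<dots> \<le> ennreal (sqrt pi * M)"
      using le real by (intro ennreal_leI real_le_lsqrt) (auto simp: power_mult_distrib mult.commute nn)
    also have "\<dots> = ennreal (sqrt pi) * sup_norm u" using real by (simp add: ennreal_mult)
    finally show ?thesis .
  qed
  show ?thesis
    unfolding asymp_le_def
  proof (intro allI impI always_eventually)
    fix \<epsilon> :: real and n assume "\<epsilon> > 0"
    then have "1 \<le> ennreal (1 + \<epsilon>)"
      using ennreal_leI[of 1 "1 + \<epsilon>"] unfolding ennreal_1 by linarith
    then have "ennreal (sqrt pi) * sup_norm u \<le> ennreal (1 + \<epsilon>) * (ennreal (sqrt pi) * sup_norm u)"
      using mult_right_mono[of 1 "ennreal (1 + \<epsilon>)" "ennreal (sqrt pi) * sup_norm u"] by simp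
    with main show "wL2_norm (mapped_weight i \<alpha> L) (interpolant i \<alpha> L n u)
        \<le> ennreal (1 + \<epsilon>) * (ennreal (sqrt pi) * sup_norm u)" by (rule order_trans)
  qed
qed

end
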